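(* Consider a passive, low-loss optical fiber of length $L>0$ carrying constant power, with light whose time-domain envelope $x(t)$ is produced by intensity (amplitude) modulation, $x(t)=a(t)$, or phase modulation, $x(t)=e^{i\phi(t)}$, with a noise source ($a$ or $\phi$) that is a stationary zero-mean Gaussian random process whose bandwidth is much wider than the Brillouin gain bandwidth $\Delta\nu_B$. Model the fiber as $k=L/L_B$ segments of length $L_B=\dfrac{c}{n_{fiber}\,\Delta\nu_B}$, and let $S_k(f)$ be the effective power spectrum obtained from the $k$ segments, with mean $\bar S(f)=\langle S_k(f)\rangle$. Let the effective spectral width be $$\sigma=\left\langle\frac{\left(\int S_k(f)\,df\right)^2}{\int S_k^2(f)\,df}\right\rangle,$$ approximated, because of the spectral smoothing introduced by the time windows, by the discrete form $$\sigma=\Delta\nu_B\left\langle\frac{\left(\sum_n S_k(f_n)\right)^2}{\sum_n S_k^2(f_n)}\right\rangle,\qquad f_n=n\,\Delta\nu_B,\ n\in\mathbb{Z}.$$ Assume that the spectral samples $S_k(f_n)$ at different $n$ are independent of each other, and that the variation in total power is low on the time scale of the Brillouin process (continuous-wave operation), so that the discrete form simplifies to $$\sigma=\Delta\nu_B\,\frac{\left(\sum_n\bar S(f_n)\right)^2}{\sum_n\langle S_k^2(f_n)\rangle}.$$ Then, within these approximations, $$\sigma=\frac{k}{k+1}\,\sigma_{ideal},\qquad \sigma_{ideal}=\Delta\nu_B\,\frac{\left(\sum_n\bar S(f_n)\right)^2}{\sum_n\bar S^2(f_n)},$$ where $\sigma_{ideal}$ is the spectral width corresponding to the power spectral density of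 the waveform. Converted to enhancement factors of the stimulated Brillouin scattering (SBS) threshold, this gives $$EF=\frac{k}{k+1}\,EF_{ideal},$$ that is, in terms of the fiber length $L$ (treated as a continuous parameter), $$EF=\frac{L/L_B}{(L/L_B)+1}\,EF_{ideal}=\frac{\Delta\nu_B}{\Delta\nu_B+\dfrac{c}{n_{fiber}L}}\,EF_{ideal}.$$
   Context: $\langle\cdot\rangle$ denotes expectation; $c$ is the speed of light and $n_{fiber}$ the effective refractive index of the fiber. $\Delta\nu_B$ is the bandwidth of the Lorentzian Brillouin gain profile $g_B(f)$. The Brillouin process is modelled as acting on the signal in time windows of size $1/\Delta\nu_B$, equivalently fiber segments of length $L_B$. The effective spectrum is, up to normalization, $$S_k(f_n)=\sum_{i=1}^{k}|X_i^r(f_n)|^2+\sum_{i=1}^{k}|X_i^c(f_n)|^2,$$ where $X_i^r(f_n)$ and $X_i^c(f_n)$ are the real and imaginary components at $f_n$ of the Fourier transform of $x(t)W_i(t)$, and $W_i$ is the windowing function of the $i$-th segment; in this model $S_k(f_n)$ is chi-squared distributed of order $2k$ (up to scale), and its mean $\bar S(f_n)$ is the power spectral density. The enhancement factor of the SBS threshold for a laser spectrum $S(f)$ is $$EF=\frac{\sigma(S(f)\otimes g_B(f))}{\sigma(g_B(f))},$$ where $\otimes$ is convolution and $\sigma(\cdot)$ is a measure of spectral width. $EF$ is the enhancement factor for the effective spectrum of the fiber (the effect of the convolution with $g_B$ being captured by the time windowing), and $EF_{ideal}$ is the one anticipated from the power spectral density alone. The formula is derived with $k$ the number of segments, and the discrete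 factor is then replaced by its continuous counterpart in $L$. *)

theory Defs
  imports "HOL-Probability.Probability"
begin

section \<open>Noise source and modulated waveform\<close>

text \<open>The second alternative is the degenerate centred normal law (variance 0).\<close>
definition centred_normal :: "'w measure \<Rightarrow> ('w \<Rightarrow> real) \<Rightarrow> bool" where
  "centred_normal M Z \<longleftrightarrow> Z \<in> borel_measurable M \<and>
     ((\<exists>s>0. distributed M lborel Z (normal_density 0 s)) \<or> (AE \<omega> in M. Z \<omega> = 0))"

text \<open>Joint normality of the finite-dimensional marginals is expressed through their linear
  combinations; the joint measurability makes time integrals of the paths random variables.\<close>
definition zero_mean_gaussian_process :: "'w measure \<Rightarrow> (real \<Rightarrow> 'w \<Rightarrow> real) \<Rightarrow> bool" where
  "zero_mean_gaussian_process M a \<longleftrightarrow>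
     (\<lambda>(t, \<omega>). a t \<omega>) \<in> borel_measurable (lborel \<Otimes>\<^sub>M M) \<and>
     (\<forall>T c. finite T \<longrightarrow> centred_normal M (\<lambda>\<omega>. \<Sum>t\<in>T. c t * a t \<omega>))"

definition stationary_process :: "'w measure \<Rightarrow> (real \<Rightarrow> 'w \<Rightarrow> real) \<Rightarrow> bool" where
  "stationary_process M a \<longleftrightarrow>
     (\<forall>T h. finite T \<longrightarrow>
        distr M (Pi\<^sub>M T (\<lambda>_. borel)) (\<lambda>\<omega>. \<lambda>t\<in>T. a (t + h) \<omega>) =
        distr M (Pi\<^sub>M T (\<lambda>_. borel)) (\<lambda>\<omega>. \<lambda>t\<in>T. a t \<omega>))"

definition spectral_width :: "(real \<Rightarrow> real) \<Rightarrow> real" where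
  "spectral_width g = (LINT f|lborel. g f)\<^sup>2 / (LINT f|lborel. (g f)\<^sup>2)"

text \<open>\<open>N\<close> is the (two-sided) power spectral density of the noise source, by the
  Wiener--Khinchin relation with the autocovariance.\<close>
definition noise_psd :: "'w measure \<Rightarrow> (real \<Rightarrow> 'w \<Rightarrow> real) \<Rightarrow> (real \<Rightarrow> real) \<Rightarrow> bool" where
  "noise_psd M a N \<longleftrightarrow>
     (\<forall>f. 0 \<le> N f) \<and> integrable lborel N \<and> integrable lborel (\<lambda>f. (N f)\<^sup>2) \<and>
     (\<forall>s t. (LINT \<omega>|M. a s \<omega> * a t \<omega>) = (LINT f|lborel. N f * cos (2 * pi * f * (s - t))))"

definition amplitude_modulated :: "(real \<Rightarrow> 'w \<Rightarrow> real) \<Rightarrow> real \<Rightarrow> 'w \<Rightarrow> complex" where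
  "amplitude_modulated a t \<omega> = complex_of_real (a t \<omega>)"

definition phase_modulated :: "(real \<Rightarrow> 'w \<Rightarrow> real) \<Rightarrow> real \<Rightarrow> 'w \<Rightarrow> complex" where
  "phase_modulated \<phi> t \<omega> = cis (\<phi> t \<omega>)"


section \<open>The effective spectrum of the segmented fiber\<close>

definition segment_length :: "real \<Rightarrow> real \<Rightarrow> real \<Rightarrow> real" where
  "segment_length c n_fiber \<Delta>\<nu> = c / (n_fiber * \<Delta>\<nu>)"

text \<open>The \<open>i\<close>-th segment, \<open>i \<ge> 1\<close>, sees the signal in the \<open>i\<close>-th time slot of size
  \<open>1 / \<Delta>\<nu>\<close>; the shape of the window inside its slot is left free.\<close>
definition segment_window :: "real \<Rightarrow> nat \<Rightarrow> (real \<Rightarrow> real) \<Rightarrow> bool" where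
  "segment_window \<Delta>\<nu> i w \<longleftrightarrow> w \<in> borel_measurable borel \<and> bounded (range w) \<and>
     (\<forall>t. t \<notin> {(real i - 1) / \<Delta>\<nu> .. real i / \<Delta>\<nu>} \<longrightarrow> w t = 0)"

definition windowed_fourier ::
    "(real \<Rightarrow> 'w \<Rightarrow> complex) \<Rightarrow> (real \<Rightarrow> real) \<Rightarrow> real \<Rightarrow> 'w \<Rightarrow> complex" where
  "windowed_fourier x w f \<omega> =
     (LINT t|lborel. x t \<omega> * complex_of_real (w t) * cis (- (2 * pi * f * t)))"

text \<open>\<open>A > 0\<close> is the free normalization of the spectrum. All segments enter with equal weight:
  the fiber is passive and low-loss and carries constant power.\<close>
definition effective_spectrum ::
    "real \<Rightarrow> (real \<Rightarrow> 'w \<Rightarrow> complex) \<Rightarrow> (nat \<Rightarrow> real \<Rightarrow> real) \<Rightarrow> nat \<Rightarrow> real \<Rightarrow> 'w \<Rightarrow> real" where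
  "effective_spectrum A x W k f \<omega> =
     A * ((\<Sum>i=1..k. (Re (windowed_fourier x (W i) f \<omega>))\<^sup>2) +
          (\<Sum>i=1..k. (Im (windowed_fourier x (W i) f \<omega>))\<^sup>2))"

text \<open>The law of a scaled sum of squares of \<open>m\<close> independent standard normal variables.\<close>
definition scaled_chi_squared :: "'w measure \<Rightarrow> nat \<Rightarrow> ('w \<Rightarrow> real) \<Rightarrow> bool" where
  "scaled_chi_squared M m Y \<longleftrightarrow> Y \<in> borel_measurable M \<and>
     (\<exists>s\<ge>0. distr M borel Y =
        distr (Pi\<^sub>M {..<m} (\<lambda>_. density lborel std_normal_density)) borel
              (\<lambda>z. s * (\<Sum>i<m. (z i)\<^sup>2)))"


section \<open>Effective spectral widths\<close>

definition mean_width :: "'w measure \<Rightarrow> (real \<Rightarrow> 'w \<Rightarrow> real) \<Rightarrow> real" where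
  "mean_width M S = (LINT \<omega>|M. spectral_width (\<lambda>f. S f \<omega>))"

text \<open>In the discrete forms, \<open>Y n\<close> stands for the sample at frequency \<open>n * \<Delta>\<nu>\<close>.\<close>
definition discrete_width :: "'w measure \<Rightarrow> real \<Rightarrow> (int \<Rightarrow> 'w \<Rightarrow> real) \<Rightarrow> real" where
  "discrete_width M \<Delta>\<nu> Y =
     \<Delta>\<nu> * (LINT \<omega>|M. (\<Sum>\<^sub>\<infinity>n. Y n \<omega>)\<^sup>2 / (\<Sum>\<^sub>\<infinity>n. (Y n \<omega>)\<^sup>2))"

definition cw_width :: "'w measure \<Rightarrow> real \<Rightarrow> (int \<Rightarrow> 'w \<Rightarrow> real) \<Rightarrow> real" where
  "cw_width M \<Delta>\<nu> Y =
     \<Delta>\<nu> * ((\<Sum>\<^sub>\<infinity>n. (LINT \<omega>|M. Y n \<omega>))\<^sup>2 / (\<Sum>\<^sub>\<infinity>n. (LINT \<omega>|M. (Y n \<omega>)\<^sup>2)))"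

definition psd_width :: "real \<Rightarrow> (int \<Rightarrow> real) \<Rightarrow> real" where
  "psd_width \<Delta>\<nu> P = \<Delta>\<nu> * ((\<Sum>\<^sub>\<infinity>n. P n)\<^sup>2 / (\<Sum>\<^sub>\<infinity>n. (P n)\<^sup>2))"

text \<open>Relative fluctuation of the total power at most \<open>\<delta>\<close> (in standard deviation).\<close>
definition low_power_variation :: "'w measure \<Rightarrow> real \<Rightarrow> (int \<Rightarrow> 'w \<Rightarrow> real) \<Rightarrow> bool" where
  "low_power_variation M \<delta> Y \<longleftrightarrow>
     integrable M (\<lambda>\<omega>. (\<Sum>\<^sub>\<infinity>n. Y n \<omega>)\<^sup>2) \<and>
     (LINT \<omega>|M. ((\<Sum>\<^sub>\<infinity>n. Y n \<omega>) - (LINT \<omega>'|M. (\<Sum>\<^sub>\<infinity>n. Y n \<omega>')))\<^sup>2)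
       \<le> \<delta>\<^sup>2 * (LINT \<omega>|M. (\<Sum>\<^sub>\<infinity>n. Y n \<omega>))\<^sup>2"


section \<open>Enhancement factors\<close>

text \<open>Lorentzian gain profile with peak \<open>g0\<close> and full width at half maximum \<open>\<Delta>\<nu>\<close>.\<close>
definition brillouin_gain :: "real \<Rightarrow> real \<Rightarrow> real \<Rightarrow> real" where
  "brillouin_gain g0 \<Delta>\<nu> f = g0 * (\<Delta>\<nu> / 2)\<^sup>2 / (f\<^sup>2 + (\<Delta>\<nu> / 2)\<^sup>2)"

text \<open>\<open>w\<close> is the width of the spectrum as smoothed by the gain profile \<open>g\<close>. The widths of the
  effective spectrum are of this kind, since the time windows of size \<open>1 / \<Delta>\<nu>\<close> stand for the
  convolution with \<open>g\<close>.\<close>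
definition enhancement_factor :: "(real \<Rightarrow> real) \<Rightarrow> real \<Rightarrow> real" where
  "enhancement_factor g w = w / spectral_width g"

text \<open>The factor obtained for \<open>k\<close> segments, read as a function of a real number
  \<open>\<kappa> = l / L\<^sub>B\<close> of segments.\<close>
definition continuous_enhancement_factor :: "real \<Rightarrow> real \<Rightarrow> real \<Rightarrow> real" where
  "continuous_enhancement_factor L\<^sub>B EF_ideal l = (let \<kappa> = l / L\<^sub>B in \<kappa> / (\<kappa> + 1) * EF_ideal)"

text \<open>How the approximations are rendered: the windowed spectrum of a genuine waveform is chi-squared
  with independent samples only approximately (a phase-modulated envelope has a bounded
  windowed transform; a real envelope has a symmetric spectrum). The effective spectrum
  \<open>S\<close> computed from the waveform is therefore kept apart from the samples \<open>Y n\<close> of the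
  statistical model, which have the same means, and every passage of the argument that is
  only approximate carries an arbitrary tolerance, in units of the ideal width. Literal
  equalities are the case of zero tolerances, and the identification of model and waveform is
  the case \<open>Y n = S (n * \<Delta>\<nu>)\<close>.\<close>

end

theory Submission
  imports Defs
begin

text \<open>A sum \<open>Q\<close> of squares of \<open>m\<close> independent standard normal variables has mean \<open>m\<close> and second
  moment \<open>m\<^sup>2 + 2 m\<close>, so each spectral sample satisfies
  \<open>\<langle>Y\<^sup>2\<rangle> = (1 + 2 / m) \<langle>Y\<rangle>\<^sup>2\<close>, which for \<open>m = 2 k\<close> is \<open>(k + 1) / k\<close> times the squared mean.
  This factor does not depend on the frequency and leaves the sum in the denominator of \<open>\<sigma>\<close>.\<close>

abbreviation std_normal :: "real measure" where
  "std_normal \<equiv> density lborel std_normal_density"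

text \<open>The quotient of factorials is the double factorial (2n - 1)!!. Even powers suffice,
  since coordinates enter only through their squares.\<close>

lemma std_normal_even_moment:
  shows integrable_std_normal_even_power: "integrable std_normal (\<lambda>z. z ^ (2 * n))"
    and integral_std_normal_even_power:
      "(LINT z|std_normal. z ^ (2 * n)) = fact (2 * n) / (2 ^ n * fact n)"
proof -
  note moment = std_normal_moment_even[of n]
  show "integrable std_normal (\<lambda>z. z ^ (2 * n))"
    using moment
    by (subst integrable_density) (auto simp: has_bochner_integral_iff)
  show "(LINT z|std_normal. z ^ (2 * n)) = fact (2 * n) / (2 ^ n * fact n)"
    using moment by (subst integral_density) (auto simp: has_bochner_integral_iff)
qed

context
  fixes I :: "'i set"
  assumes finite_I: "finite I"
begin

text \<open>By Fubini the integral of a product of one-coordinate functions factors. Leaving the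
  exponents \<open>n l\<close> free lets the same statement serve for one square and for a product
  of two.\<close>

lemma std_normal_mixed_moment:
  shows integrable_std_normal_mixed_moment:
      "integrable (Pi\<^sub>M I (\<lambda>_. std_normal)) (\<lambda>z. \<Prod>l\<in>I. z l ^ (2 * n l))"
    and integral_std_normal_mixed_moment:
      "(LINT z|Pi\<^sub>M I (\<lambda>_. std_normal). (\<Prod>l\<in>I. z l ^ (2 * n l))) =
       (\<Prod>l\<in>I. fact (2 * n l) / (2 ^ n l * fact (n l)))"
proof -
  interpret prob_space std_normal
    by (rule prob_space_normal_density) simp
  interpret product_sigma_finite "\<lambda>_::'i. std_normal"
    by unfold_locales
  show "integrable (Pi\<^sub>M I (\<lambda>_. std_normal)) (\<lambda>z. \<Prod>l\<in>I. z l ^ (2 * n l))"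
    by (intro product_integrable_prod finite_I integrable_std_normal_even_power)
  show "(LINT z|Pi\<^sub>M I (\<lambda>_. std_normal). (\<Prod>l\<in>I. z l ^ (2 * n l))) =
       (\<Prod>l\<in>I. fact (2 * n l) / (2 ^ n l * fact (n l)))"
    by (subst product_integral_prod)
       (auto simp: finite_I integrable_std_normal_even_power integral_std_normal_even_power)
qed

lemma integral_std_normal_component_square:
  assumes "i \<in> I"
  shows "integrable (Pi\<^sub>M I (\<lambda>_. std_normal)) (\<lambda>z. (z i)\<^sup>2)"
    and "(LINT z|Pi\<^sub>M I (\<lambda>_. std_normal). (z i)\<^sup>2) = 1"
proof -
  \<comment> \<open>Exponent 0 makes every factor other than the one at \<open>i\<close> equal to
    1.\<close>
  have factors: "(\<Prod>l\<in>I. z l ^ (2 * of_bool (l = i))) = (z i)\<^sup>2" for z :: "'i \<Rightarrow> real"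
  proof -
    have "(\<Prod>l\<in>I. z l ^ (2 * of_bool (l = i))) = (\<Prod>l\<in>I. if l = i then (z l)\<^sup>2 else 1)"
      by (intro prod.cong) auto
    then show ?thesis
      using assms finite_I by simp
  qed
  show "integrable (Pi\<^sub>M I (\<lambda>_. std_normal)) (\<lambda>z. (z i)\<^sup>2)"
    using integrable_std_normal_mixed_moment[of "\<lambda>l. of_bool (l = i)"] by (simp only: factors)
  have "(LINT z|Pi\<^sub>M I (\<lambda>_. std_normal). (z i)\<^sup>2) =
      (\<Prod>l\<in>I. fact (2 * of_bool (l = i)) / (2 ^ of_bool (l = i) * fact (of_bool (l = i))))"
    using integral_std_normal_mixed_moment[of "\<lambda>l. of_bool (l = i)"] by (simp only: factors)
  also have "\<dots> = 1"
    by (intro prod.neutral) (auto simp: fact_numeral)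
  finally show "(LINT z|Pi\<^sub>M I (\<lambda>_. std_normal). (z i)\<^sup>2) = 1" .
qed

lemma integral_std_normal_component_squares:
  assumes "i \<in> I" "j \<in> I"
  shows "integrable (Pi\<^sub>M I (\<lambda>_. std_normal)) (\<lambda>z. (z i)\<^sup>2 * (z j)\<^sup>2)"
    and "(LINT z|Pi\<^sub>M I (\<lambda>_. std_normal). (z i)\<^sup>2 * (z j)\<^sup>2) = 1 + (if i = j then 2 else 0)"
proof -
  \<comment> \<open>\<open>?n l\<close> counts how often \<open>l\<close> occurs among
    \<open>i\<close> and \<open>j\<close>, so the cases \<open>i = j\<close> and
    \<open>i \<noteq> j\<close> need no separate treatment.\<close>
  let ?n = "\<lambda>l. of_bool (l = i) + of_bool (l = j) :: nat"
  have factors: "(\<Prod>l\<in>I. z l ^ (2 * ?n l)) = (z i)\<^sup>2 * (z j)\<^sup>2" for z :: "'i \<Rightarrow> real"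
  proof -
    have "(\<Prod>l\<in>I. z l ^ (2 * ?n l)) =
        (\<Prod>l\<in>I. (if l = i then (z l)\<^sup>2 else 1) * (if l = j then (z l)\<^sup>2 else 1))"
      by (intro prod.cong) (auto simp: power2_eq_square numeral_eq_Suc)
    then show ?thesis
      using assms finite_I by (simp add: prod.distrib)
  qed
  show "integrable (Pi\<^sub>M I (\<lambda>_. std_normal)) (\<lambda>z. (z i)\<^sup>2 * (z j)\<^sup>2)"
    using integrable_std_normal_mixed_moment[of ?n] by (simp only: factors)
  have "(LINT z|Pi\<^sub>M I (\<lambda>_. std_normal). (z i)\<^sup>2 * (z j)\<^sup>2) =
      (\<Prod>l\<in>I. fact (2 * ?n l) / (2 ^ ?n l * fact (?n l)))"
    using integral_std_normal_mixed_moment[of ?n] by (simp only: factors)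
  \<comment> \<open>The fourth moment is 4! / (2^2 * 2!) = 3, reached only on the diagonal; the
    second and zeroth moments are 1.\<close>
  also have "\<dots> = (\<Prod>l\<in>I. if l = i then (if i = j then 3 else 1) else 1)"
    by (intro prod.cong) (auto simp: fact_numeral numeral_2_eq_2)
  also have "\<dots> = 1 + (if i = j then 2 else 0)"
    using assms finite_I by simp
  finally show "(LINT z|Pi\<^sub>M I (\<lambda>_. std_normal). (z i)\<^sup>2 * (z j)\<^sup>2) =
      1 + (if i = j then 2 else 0)" .
qed

lemma integral_chi_squared:
  "(LINT z|Pi\<^sub>M I (\<lambda>_. std_normal). (\<Sum>i\<in>I. (z i)\<^sup>2)) = real (card I)"
  by (simp add: integral_std_normal_component_square)

lemma integral_chi_squared_square:
  "(LINT z|Pi\<^sub>M I (\<lambda>_. std_normal). (\<Sum>i\<in>I. (z i)\<^sup>2)\<^sup>2) = (real (card I))\<^sup>2 + 2 * real (card I)"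
proof -
  \<comment> \<open>Expanding the square gives one term per pair of indices; each pair contributes
    1, and each diagonal pair 2 more.\<close>
  have "(LINT z|Pi\<^sub>M I (\<lambda>_. std_normal). (\<Sum>i\<in>I. (z i)\<^sup>2)\<^sup>2) =
      (\<Sum>i\<in>I. \<Sum>j\<in>I. 1 + (if i = j then 2 else 0))"
    unfolding power2_eq_square[of "sum _ _"] sum_product
    by (simp add: integral_std_normal_component_squares)
  also have "\<dots> = (real (card I))\<^sup>2 + 2 * real (card I)"
    using finite_I by (simp add: sum.distrib power2_eq_square algebra_simps)
  finally show ?thesis .
qed

end

text \<open>The unknown scale cancels: the second moment and the squared mean both carry the factor
  s^2.\<close>

lemma scaled_chi_squared_second_moment:
  assumes "scaled_chi_squared M m Y" "m > 0"
  shows "(LINT \<omega>|M. (Y \<omega>)\<^sup>2) = (1 + 2 / real m) * (LINT \<omega>|M. Y \<omega>)\<^sup>2"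
proof -
  define P where "P = Pi\<^sub>M {..<m} (\<lambda>_. std_normal)"
  define Q where "Q = (\<lambda>z :: nat \<Rightarrow> real. \<Sum>i<m. (z i)\<^sup>2)"
  obtain s where Y: "Y \<in> borel_measurable M"
    and law: "distr M borel Y = distr P borel (\<lambda>z. s * Q z)"
    using assms(1) by (auto simp: scaled_chi_squared_def P_def Q_def)
  have Q [measurable]: "Q \<in> borel_measurable P"
    unfolding P_def Q_def by measurable
  \<comment> \<open>Only the law of \<open>Y\<close> is given, so its moments are computed through
    the image measure on the reals.\<close>
  have transfer: "(LINT \<omega>|M. g (Y \<omega>)) = (LINT z|P. g (s * Q z))"
    if "g \<in> borel_measurable borel" for g :: "real \<Rightarrow> real"
  proof -
    have "(LINT \<omega>|M. g (Y \<omega>)) = (LINT y|distr M borel Y. g y)"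
      using Y that by (simp add: integral_distr)
    also have "\<dots> = (LINT z|P. g (s * Q z))"
      unfolding law using that by (intro integral_distr) measurable
    finally show ?thesis .
  qed
  have "(LINT \<omega>|M. Y \<omega>) = s * real m"
    using transfer[of "\<lambda>y. y"] integral_chi_squared[of "{..<m}"] by (simp add: P_def Q_def)
  moreover have "(LINT \<omega>|M. (Y \<omega>)\<^sup>2) = s\<^sup>2 * ((real m)\<^sup>2 + 2 * real m)"
    using transfer[of "\<lambda>y. y\<^sup>2"] integral_chi_squared_square[of "{..<m}"]
    by (simp add: P_def Q_def power_mult_distrib)
  ultimately show ?thesis
    using assms(2) by (simp add: field_simps power2_eq_square)
qed

lemma cw_width_scaled_chi_squared:
  assumes "\<And>n. scaled_chi_squared M (2 * k) (Y n)" "k > 0"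
  shows "cw_width M \<Delta>\<nu> Y = real k / (real k + 1) * psd_width \<Delta>\<nu> (\<lambda>n. LINT \<omega>|M. Y n \<omega>)"
proof -
  have second_moment:
    "(LINT \<omega>|M. (Y n \<omega>)\<^sup>2) = (real k + 1) / real k * (LINT \<omega>|M. Y n \<omega>)\<^sup>2" for n
    using scaled_chi_squared_second_moment[OF assms(1)[of n]] assms(2) by (simp add: field_simps)
  show ?thesis
    \<comment> \<open>The constant leaves the infinite sum without a summability condition, as a
      divergent \<open>infsum\<close> is 0 by convention.\<close>
    unfolding cw_width_def psd_width_def second_moment infsum_cmult_right'
    using assms(2) by (simp add: mult_ac)
qed

text \<open>Numerator and denominator are both scaled by \<open>c / (n_fiber * l)\<close>, the
  reciprocal of \<open>l / segment_length c n_fiber \<Delta>\<nu>\<close> times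
  \<open>\<Delta>\<nu>\<close>.\<close>

lemma segment_count_factor:
  assumes "c > 0" "n_fiber > 0" "\<Delta>\<nu> > 0" "l > 0"
  shows "(l / segment_length c n_fiber \<Delta>\<nu>) / (l / segment_length c n_fiber \<Delta>\<nu> + 1) =
    \<Delta>\<nu> / (\<Delta>\<nu> + c / (n_fiber * l))"
proof -
  \<comment> \<open>These are the denominators left after clearing the inner fractions on the two
    sides; being nonzero, they permit cross-multiplication.\<close>
  have "l * (n_fiber * \<Delta>\<nu>) + c > 0" "\<Delta>\<nu> * (n_fiber * l) + c > 0"
    using assms by (auto intro!: add_pos_pos mult_pos_pos)
  then show ?thesis
    using assms by (simp add: segment_length_def field_simps)
qed

lemma spectral_width_nonneg: "spectral_width g \<ge> 0"
  by (simp add: spectral_width_def)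

lemma enhancement_factor_mult: "enhancement_factor g (r * w) = r * enhancement_factor g w"
  by (simp add: enhancement_factor_def)

text \<open>Division by the gain width is linear and monotone. Nonnegativity of that width is
  enough, because division by 0 yields 0.\<close>

lemma enhancement_factor_diff_le:
  assumes "\<bar>v - r * w\<bar> \<le> e * w"
  shows "\<bar>enhancement_factor g v - r * enhancement_factor g w\<bar> \<le> e * enhancement_factor g w"
proof -
  have "\<bar>v - r * w\<bar> / spectral_width g \<le> e * w / spectral_width g"
    by (intro divide_right_mono assms spectral_width_nonneg)
  then show ?thesis
    by (simp add: enhancement_factor_def spectral_width_nonneg abs_divide flip: diff_divide_distrib)
qed

theorem mainTheorem1:
  fixes M :: "'w measure"
    and a :: "real \<Rightarrow> 'w \<Rightarrow> real" and N :: "real \<Rightarrow> real"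
    and x :: "real \<Rightarrow> 'w \<Rightarrow> complex"
    and W :: "nat \<Rightarrow> real \<Rightarrow> real"
    and S :: "real \<Rightarrow> 'w \<Rightarrow> real" and Y :: "int \<Rightarrow> 'w \<Rightarrow> real" and Sbar :: "int \<Rightarrow> real"
    and c n_fiber \<Delta>\<nu> L L\<^sub>B A g0 \<epsilon>\<^sub>d \<epsilon>\<^sub>m \<delta> :: real
    and k :: nat
    and g\<^sub>B :: "real \<Rightarrow> real"
    and \<sigma> \<sigma>_ideal EF EF_ideal :: real
  assumes "prob_space M"
    and constants: "c > 0" "n_fiber > 0" "\<Delta>\<nu> > 0" "L > 0" "A > 0" "g0 > 0"
    \<comment> \<open>segmentation of the fiber\<close>
    and L\<^sub>B: "L\<^sub>B = segment_length c n_fiber \<Delta>\<nu>"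
    and k: "real k = L / L\<^sub>B"
    and windows: "\<And>i. i \<in> {1..k} \<Longrightarrow> segment_window \<Delta>\<nu> i (W i)"
    \<comment> \<open>waveform; how much wider the noise is than the gain enters through the tolerances\<close>
    and noise: "zero_mean_gaussian_process M a" "stationary_process M a" "noise_psd M a N"
    and wideband: "\<Delta>\<nu> < spectral_width N"
    and waveform: "x = amplitude_modulated a \<or> x = phase_modulated a"
    and S: "S = effective_spectrum A x W k"
    and Sbar: "\<And>n. Sbar n = (LINT \<omega>|M. S (of_int n * \<Delta>\<nu>) \<omega>)"
    and finite_power: "Sbar summable_on UNIV" "(\<Sum>\<^sub>\<infinity>n. Sbar n) > 0"
    \<comment> \<open>statistical model of the spectral samples\<close>
    and chi_squared: "\<And>n. scaled_chi_squared M (2 * k) (Y n)"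
    and mean_Y: "\<And>n. (LINT \<omega>|M. Y n \<omega>) = Sbar n"
    and indep: "prob_space.indep_vars M (\<lambda>_. borel) Y UNIV"
    \<comment> \<open>widths and enhancement factors\<close>
    and \<sigma>: "\<sigma> = cw_width M \<Delta>\<nu> Y"
    and \<sigma>_ideal: "\<sigma>_ideal = psd_width \<Delta>\<nu> Sbar"
    and g\<^sub>B: "g\<^sub>B = brillouin_gain g0 \<Delta>\<nu>"
    and EF: "EF = enhancement_factor g\<^sub>B \<sigma>"
    and EF_ideal: "EF_ideal = enhancement_factor g\<^sub>B \<sigma>_ideal"
    \<comment> \<open>approximations: discretization, chi-squared model, continuous-wave operation\<close>
    and discretization: "\<bar>mean_width M S - discrete_width M \<Delta>\<nu> (\<lambda>n. S (of_int n * \<Delta>\<nu>))\<bar> \<le> \<epsilon>\<^sub>d * \<sigma>_ideal"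
    and modelling: "\<bar>discrete_width M \<Delta>\<nu> (\<lambda>n. S (of_int n * \<Delta>\<nu>)) - discrete_width M \<Delta>\<nu> Y\<bar> \<le> \<epsilon>\<^sub>m * \<sigma>_ideal"
    and low_variation: "low_power_variation M \<delta> Y"
    and cw: "\<bar>discrete_width M \<Delta>\<nu> Y - \<sigma>\<bar> \<le> \<delta> * \<sigma>_ideal"
  shows "\<sigma> = real k / (real k + 1) * \<sigma>_ideal \<and>
    EF = real k / (real k + 1) * EF_ideal \<and>
    EF = (L / L\<^sub>B) / ((L / L\<^sub>B) + 1) * EF_ideal \<and>
    EF = \<Delta>\<nu> / (\<Delta>\<nu> + c / (n_fiber * L)) * EF_ideal \<and>
    EF = continuous_enhancement_factor L\<^sub>B EF_ideal L \<and>
    (\<forall>l>0.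
       continuous_enhancement_factor L\<^sub>B EF_ideal l = (l / L\<^sub>B) / ((l / L\<^sub>B) + 1) * EF_ideal \<and>
       continuous_enhancement_factor L\<^sub>B EF_ideal l = \<Delta>\<nu> / (\<Delta>\<nu> + c / (n_fiber * l)) * EF_ideal) \<and>
    \<bar>mean_width M S - real k / (real k + 1) * \<sigma>_ideal\<bar> \<le> (\<epsilon>\<^sub>d + \<epsilon>\<^sub>m + \<delta>) * \<sigma>_ideal \<and>
    \<bar>enhancement_factor g\<^sub>B (mean_width M S) - real k / (real k + 1) * EF_ideal\<bar>
      \<le> (\<epsilon>\<^sub>d + \<epsilon>\<^sub>m + \<delta>) * EF_ideal"
proof -
  have "L\<^sub>B > 0"
    using constants by (simp add: L\<^sub>B segment_length_def)
  \<comment> \<open>A positive fiber length forces at least one segment, hence a positive number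
    \<open>2 * k\<close> of degrees of freedom.\<close>
  with k constants have "k > 0"
    by (metis divide_pos_pos of_nat_0_less_iff)
  have width: "\<sigma> = real k / (real k + 1) * \<sigma>_ideal"
    using cw_width_scaled_chi_squared[OF chi_squared \<open>k > 0\<close>] by (simp add: \<sigma> \<sigma>_ideal mean_Y)
  have EF_k: "EF = real k / (real k + 1) * EF_ideal"
    unfolding EF EF_ideal width by (rule enhancement_factor_mult)
  have EF_L: "EF = (L / L\<^sub>B) / ((L / L\<^sub>B) + 1) * EF_ideal"
    using EF_k by (simp only: k)
  have factor: "(l / L\<^sub>B) / (l / L\<^sub>B + 1) = \<Delta>\<nu> / (\<Delta>\<nu> + c / (n_fiber * l))" if "l > 0" for l
    unfolding L\<^sub>B using constants that by (intro segment_count_factor)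
  \<comment> \<open>Triangle inequality through the discrete widths of \<open>S\<close> and of
    \<open>Y\<close>, ending at \<open>\<sigma>\<close>; the three tolerances add up.\<close>
  have mean_width: "\<bar>mean_width M S - real k / (real k + 1) * \<sigma>_ideal\<bar> \<le> (\<epsilon>\<^sub>d + \<epsilon>\<^sub>m + \<delta>) * \<sigma>_ideal"
    using discretization modelling cw unfolding width[symmetric] distrib_right by linarith
  have "\<bar>enhancement_factor g\<^sub>B (mean_width M S) - real k / (real k + 1) * EF_ideal\<bar>
      \<le> (\<epsilon>\<^sub>d + \<epsilon>\<^sub>m + \<delta>) * EF_ideal"
    unfolding EF_ideal by (rule enhancement_factor_diff_le[OF mean_width])
  then show ?thesis
    using width EF_k EF_L mean_width factor[OF \<open>L > 0\<close>]
    unfolding continuous_enhancement_factor_def Let_def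
    by (intro conjI allI impI) (simp_all only: factor)
qed

end
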